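(* Let $n\geq 1$ be an integer, let $\pi_1,\ldots,\pi_n$ be independent uniformly distributed random permutations of $\{1,2\}$, and let $F_2$ be Friedman's statistic with $r=2$ (see context). Then $$d_{\mathrm{W}}(\mathcal{L}(F_2),\chi_{(1)}^2)\leq\frac{1}{\sqrt{n}}\bigg(87+\frac{48}{\sqrt{n}}\bigg),$$ and, for every $h\in C_b^{1,2}(\mathbb{R}^+)$, $$|\mathbb{E}[h(F_2)]-\chi_{(1)}^2h|\leq\frac{1}{n}\bigg(69+\frac{43}{n}\bigg)\{\|h'\|+\|h''\|\},$$ where $\chi_{(1)}^2h$ denotes $\mathbb{E}[h(Y_1)]$ for $Y_1\sim\chi_{(1)}^2$.
   Context: Friedman's statistic: for an integer $r\ge2$ and independent uniformly distributed random permutations $\pi_1,\ldots,\pi_n$ of $\{1,\ldots,r\}$, put $\rho_i(j)=\pi_i(j)-(r+1)/2$, $$S_j=\frac{\sqrt{12}}{\sqrt{r(r+1)n}}\sum_{i=1}^n\rho_i(j),\qquad F_r=\sum_{j=1}^r S_j^2 .$$ $\mathcal{L}(X)$ is the law of $X$ and $\chi_{(p)}^2$ is the chi-square distribution with $p$ degrees of freedom. The Wasserstein distance between the laws of real-valued random variables $X,Y$ is $d_{\mathrm{W}}(\mathcal{L}(X),\mathcal{L}(Y))=\sup_{h\in\mathcal{H}}|\mathbb{E}[h(X)]-\mathbb{E}[h(Y)]|$, where $\mathcal{H}$ is the class of Lipschitz functions with Lipschitz constant at most 1. $\mathbb{R}^+=[0,\infty)$. $C_b^{j,k}(\mathbb{R}^+)$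 is the class of functions $h:\mathbb{R}^+\to\mathbb{R}$ for which $h^{(k)}$ exists and the derivatives of order $j,j+1,\ldots,k$ are bounded ($h$ itself need not be bounded). For $g:\mathbb{R}^+\to\mathbb{R}$, $\|g\|=\sup_{x\in\mathbb{R}^+}|g(x)|$. *)

theory Defs
  imports "HOL-Probability.Probability" "HOL-Combinatorics.Permutations"
begin

abbreviation perms :: "nat \<Rightarrow> (nat \<Rightarrow> nat) set" where
  "perms r \<equiv> {p. p permutes {1..r}}"

definition iid_uniform_perms ::
    "'a measure \<Rightarrow> nat \<Rightarrow> nat \<Rightarrow> (nat \<Rightarrow> 'a \<Rightarrow> nat \<Rightarrow> nat) \<Rightarrow> bool" where
  "iid_uniform_perms M r n \<pi> \<longleftrightarrow>
     prob_space M \<and>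
     prob_space.indep_vars M (\<lambda>_. count_space (perms r)) \<pi> {1..n} \<and>
     (\<forall>i\<in>{1..n}. distr M (count_space (perms r)) (\<pi> i) = uniform_count_measure (perms r))"

definition friedman_rho :: "nat \<Rightarrow> (nat \<Rightarrow> nat) \<Rightarrow> nat \<Rightarrow> real" where
  "friedman_rho r p j = real (p j) - (real r + 1) / 2"

definition friedman_S :: "nat \<Rightarrow> nat \<Rightarrow> (nat \<Rightarrow> 'a \<Rightarrow> nat \<Rightarrow> nat) \<Rightarrow> nat \<Rightarrow> 'a \<Rightarrow> real" where
  "friedman_S r n \<pi> j \<omega> =
     sqrt 12 / sqrt (real r * (real r + 1) * real n) * (\<Sum>i=1..n. friedman_rho r (\<pi> i \<omega>) j)"

definition friedman_F :: "nat \<Rightarrow> nat \<Rightarrow> (nat \<Rightarrow> 'a \<Rightarrow> nat \<Rightarrow> nat) \<Rightarrow> 'a \<Rightarrow> real" where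
  "friedman_F r n \<pi> \<omega> = (\<Sum>j=1..r. (friedman_S r n \<pi> j \<omega>)\<^sup>2)"

(* Law of the sum of the squares of p independent standard normal variables. *)
definition chi_square :: "nat \<Rightarrow> real measure" where
  "chi_square p =
     distr (Pi\<^sub>M {1..p} (\<lambda>_. density lborel std_normal_density)) borel (\<lambda>z. \<Sum>i=1..p. (z i)\<^sup>2)"

(* chi_square p is concentrated on the nonnegative reals.  Integrating over {0..} only makes the
   value independent of h on the negative reals, where a function on [0,\<infinity>) is
   represented by arbitrary (possibly non-measurable) values. *)
definition chi_square_expectation :: "nat \<Rightarrow> (real \<Rightarrow> real) \<Rightarrow> real" where
  "chi_square_expectation p h = (LINT x:{0..}|chi_square p. h x)"

(* Arguments are laws, i.e. probability measures on borel, with finite first moment, so that all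
   the integrals exist.  The supremum is taken in ennreal, hence is meaningful even when infinite. *)
definition wasserstein :: "real measure \<Rightarrow> real measure \<Rightarrow> ennreal" where
  "wasserstein \<mu> \<nu> =
     (SUP h\<in>{h :: real \<Rightarrow> real. 1-lipschitz_on UNIV h}.
        ennreal \<bar>(LINT x|\<mu>. h x) - (LINT x|\<nu>. h x)\<bar>)"

(* A function on [0,\<infinity>) is a function real => real whose values on the negative reals are
   irrelevant; derivatives are taken within {0..}, so they are one-sided at 0. *)
definition deriv_nonneg :: "nat \<Rightarrow> (real \<Rightarrow> real) \<Rightarrow> real \<Rightarrow> real" where
  "deriv_nonneg k = (\<lambda>h x. vector_derivative h (at x within {0..})) ^^ k"

definition Cb :: "nat \<Rightarrow> nat \<Rightarrow> (real \<Rightarrow> real) set" where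
  "Cb j k = {h. (\<forall>i<k. deriv_nonneg i h differentiable_on {0..}) \<and>
                (\<forall>i\<in>{j..k}. bounded (deriv_nonneg i h ` {0..}))}"

definition sup_norm_nonneg :: "(real \<Rightarrow> real) \<Rightarrow> real" where
  "sup_norm_nonneg g = (SUP x\<in>{0..}. \<bar>g x\<bar>)"

end

theory Submission
  imports Defs "HOL-Real_Asymp.Real_Asymp"
begin

text \<open>
  For two treatments a random permutation is a fair sign, and Friedman's statistic is \<open>W\<^sup>2\<close>, where
  \<open>W\<close> is the sum of \<open>n\<close> independent signs divided by \<open>\<surd>n\<close> (lemma \<open>integral_friedman_F_two\<close>).  The
  chi-square law with one degree of freedom is the law of \<open>Z\<^sup>2\<close> for a standard normal \<open>Z\<close>.  So one
  has to compare \<open>W\<close> and \<open>Z\<close> on the even functions \<open>g w = h (w\<^sup>2)\<close>.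

  For smooth \<open>h\<close> this is done by Stein's method.  Let \<open>f\<close> solve \<open>f' - w f = g - E g(Z)\<close>, so that
  \<open>E g(W) - E g(Z) = E (f' W - W f W)\<close>.  For a sum of symmetric signs the right-hand side is exactly
  the mean error of a trapezoidal rule for \<open>f'\<close> on an interval of radius \<open>1 / \<surd>n\<close>.  This error has
  order \<open>1 / n\<close>, instead of the usual \<open>1 / \<surd>n\<close>, provided the third derivative of \<open>f\<close> is under
  control, and lemma \<open>stein_solution_bounds\<close> bounds it by a quadratic polynomial with coefficients
  linear in the suprema of \<open>|h'|\<close> and \<open>|h''|\<close>.  The result is the bound \<open>(48 A + 20 B) / n\<close> of
  \<open>rademacher_square_smooth_bound\<close>, where \<open>A\<close> and \<open>B\<close> bound \<open>|h'|\<close> and \<open>|h''|\<close>.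

  The Wasserstein bound follows by smoothing a Lipschitz function at scale \<open>1 / \<surd>n\<close>
  (\<open>rademacher_square_lipschitz_bound\<close>).
\<close>

section \<open>Comparison for the operator \<open>u' - w u\<close>\<close>

lemma DERIV_std_normal_density:
  "(std_normal_density has_real_derivative - w * std_normal_density w) (at w)"
  unfolding normal_density_def
  by (auto intro!: derivative_eq_intros simp: field_simps power2_eq_square)

lemma std_normal_density_mass:
  "integrable lborel std_normal_density" "(LINT x|lborel. std_normal_density x) = 1"
  using integral_std_normal_moment_even[of 0] integrable_std_normal_moment[of 0] by simp_all

lemma quadratic_growth_times_density_tendsto_0:
  assumes "\<And>w. w \<ge> 1 \<Longrightarrow> \<bar>u w\<bar> \<le> C * (1 + w\<^sup>2)"
  shows "((\<lambda>w. u w * std_normal_density w) \<longlongrightarrow> 0) at_top"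
proof (rule Lim_null_comparison)
  show "\<forall>\<^sub>F w in at_top. norm (u w * std_normal_density w) \<le> (C * (1 + w\<^sup>2)) * std_normal_density w"
    using eventually_ge_at_top[of 1]
  proof eventually_elim
    case (elim w)
    have "0 \<le> std_normal_density w" by simp
    then show ?case
      using assms[OF elim] by (simp add: abs_mult mult_right_mono)
  qed
  show "((\<lambda>w. (C * (1 + w\<^sup>2)) * std_normal_density w) \<longlongrightarrow> 0) at_top"
    unfolding normal_density_def by real_asymp
qed

text \<open>
  Since \<open>(u \<phi>)' = (u' - w u) \<phi>\<close> for the Gaussian density \<open>\<phi>\<close>, the hypothesis on \<open>V\<close> says that
  \<open>(V + u) \<phi>\<close> and \<open>(V - u) \<phi>\<close> are both nonincreasing; as they vanish at infinity, they are
  nonnegative.  This replaces every estimate of a Gaussian tail integral by the choice of an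
  explicit rational majorant \<open>V\<close>.
\<close>

lemma gaussian_comparison:
  fixes u u' V V' :: "real \<Rightarrow> real"
  assumes du: "\<And>y. w \<le> y \<Longrightarrow> (u has_real_derivative u' y) (at y)"
    and dV: "\<And>y. w \<le> y \<Longrightarrow> (V has_real_derivative V' y) (at y)"
    and le: "\<And>y. w \<le> y \<Longrightarrow> \<bar>u' y - y * u y\<bar> \<le> y * V y - V' y"
    and limu: "((\<lambda>y. u y * std_normal_density y) \<longlongrightarrow> 0) at_top"
    and limV: "((\<lambda>y. V y * std_normal_density y) \<longlongrightarrow> 0) at_top"
  shows "\<bar>u w\<bar> \<le> V w"
proof -
  have key: "0 \<le> V w + s * u w" if s: "\<bar>s\<bar> = 1" for s :: real
  proof -
    define D where "D y = (V y + s * u y) * std_normal_density y" for y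
    have "D y \<le> D w" if "w \<le> y" for y
    proof (rule DERIV_nonpos_imp_nonincreasing[OF that])
      fix x assume x: "w \<le> x" "x \<le> y"
      have "(D has_real_derivative (V' x + s * u' x) * std_normal_density x
               + (- x * std_normal_density x) * (V x + s * u x)) (at x)"
        unfolding D_def
        by (intro DERIV_mult DERIV_add DERIV_cmult du dV DERIV_std_normal_density x)
      moreover have "(V' x + s * u' x) * std_normal_density x
               + (- x * std_normal_density x) * (V x + s * u x)
             = (s * (u' x - x * u x) - (x * V x - V' x)) * std_normal_density x"
        by (simp add: algebra_simps)
      moreover have "s * (u' x - x * u x) \<le> x * V x - V' x"
        using le[OF x(1)] s by (auto simp: abs_if split: if_splits)
      then have "(s * (u' x - x * u x) - (x * V x - V' x)) * std_normal_density x \<le> 0"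
        by (intro mult_nonpos_nonneg) simp_all
      ultimately show "\<exists>d. (D has_real_derivative d) (at x) \<and> d \<le> 0" by auto
    qed
    then have "\<forall>\<^sub>F y in at_top. D y \<le> D w"
      by (rule eventually_mono[OF eventually_ge_at_top[of w]])
    moreover have "(D \<longlongrightarrow> 0 + s * 0) at_top"
      using tendsto_add[OF limV tendsto_mult[OF tendsto_const[of s] limu]]
      unfolding D_def by (simp add: algebra_simps)
    ultimately have "0 \<le> D w"
      by (auto intro: tendsto_upperbound[where F=at_top])
    then show ?thesis
      unfolding D_def by (simp add: zero_le_mult_iff not_le[symmetric])
        (metis mult_less_0_iff normal_density_pos zero_less_one not_le)
  qed
  show ?thesis using key[of 1] key[of "-1"] by (auto simp: abs_if)
qed

section \<open>The normal Stein equation with an even right-hand side\<close>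

lemma continuous_has_antiderivative:
  fixes f :: "real \<Rightarrow> real"
  assumes "continuous_on UNIV f"
  obtains F where "\<And>x. (F has_real_derivative f x) (at x)"
proof -
  have "\<exists>F. \<forall>x::real. -\<infinity> < ereal x \<longrightarrow> ereal x < \<infinity> \<longrightarrow> (F has_vector_derivative f x) (at x)"
    by (rule einterval_antiderivative)
      (use assms in \<open>auto simp: continuous_on_eq_continuous_at\<close>)
  then show thesis
    using that by (auto simp: has_real_derivative_iff_has_vector_derivative)
qed

text \<open>
  Let \<open>P\<close> be the antiderivative of \<open>(g - c) \<phi>\<close> that vanishes at \<open>0\<close>; the solution is \<open>P / \<phi>\<close>.
  It is odd because \<open>g\<close> is even.  The choice of \<open>c\<close> makes the total integral of \<open>(g - c) \<phi>\<close> zero,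
  and by evenness the integral over the half line is zero too, so \<open>P\<close> vanishes at infinity.
\<close>

lemma stein_solution_exists:
  fixes g :: "real \<Rightarrow> real"
  assumes cont: "continuous_on UNIV g" and even: "\<And>w. g (- w) = g w"
    and int: "integrable lborel (\<lambda>x. g x * std_normal_density x)"
    and c: "c = (LINT x|lborel. g x * std_normal_density x)"
  obtains f where "\<And>w. (f has_real_derivative w * f w + (g w - c)) (at w)"
    "\<And>w. f (- w) = - f w"
    "((\<lambda>w. f w * std_normal_density w) \<longlongrightarrow> 0) at_top"
proof -
  define q where "q x = (g x - c) * std_normal_density x" for x
  have contq: "continuous_on A q" for A
    unfolding q_def normal_density_def using continuous_on_subset[OF cont]
    by (auto intro!: continuous_intros)
  have intq: "integrable lborel q"
    unfolding q_def left_diff_distrib using int std_normal_density_mass by auto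
  have q0: "(LINT x|lborel. q x) = 0"
    unfolding q_def left_diff_distrib using int std_normal_density_mass c by simp
  obtain P0 where P0: "\<And>x. (P0 has_real_derivative q x) (at x)"
    using continuous_has_antiderivative[OF contq[of UNIV]] by blast
  define P where "P x = P0 x - P0 0" for x
  have P: "(P has_real_derivative q x) (at x)" for x
    unfolding P_def using P0[of x] by (auto intro!: derivative_eq_intros)
  have evenq: "q (- x) = q x" for x
    by (simp add: q_def even normal_density_def)
  have sumP: "P w + P (- w) = P 0 + P (- 0)" for w
  proof (rule DERIV_isconst_all[where f = "\<lambda>w. P w + P (- w)"], intro allI)
    fix x
    have "((\<lambda>w. P w + P (- w)) has_real_derivative q x + q (- x) * - 1) (at x)"
      by (intro DERIV_add P DERIV_chain2[OF P]) (auto intro!: derivative_eq_intros)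
    then show "((\<lambda>w. P w + P (- w)) has_real_derivative 0) (at x)"
      by (simp add: evenq)
  qed
  have oddP: "P (- w) = - P w" for w
    using sumP[of w] P_def[of 0] by simp
  have inth: "integrable lborel (\<lambda>x. indicator {0..} x *\<^sub>R q x)"
    using intq by (intro integrable_mult_indicator) auto
  from has_bochner_integral_even_function[OF has_bochner_integral_integrable[OF this] evenq]
  have half: "(LINT x|lborel. indicator {0..} x *\<^sub>R q x) = 0"
    using q0 by (auto dest: has_bochner_integral_integral_eq)
  have "((\<lambda>y. LINT x|lborel. indicator {..y} x *\<^sub>R (indicator {0..} x *\<^sub>R q x)) \<longlongrightarrow> 0) at_top"
    using tendsto_integral_at_top[OF _ inth] half by simp
  moreover have "\<forall>\<^sub>F y in at_top. (LINT x|lborel. indicator {..y} x *\<^sub>R (indicator {0..} x *\<^sub>R q x)) = P y"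
    using eventually_ge_at_top[of 0]
  proof eventually_elim
    case (elim y)
    have "(LINT x|lborel. indicator {0..y} x *\<^sub>R q x) = P y - P 0"
      by (rule integral_FTC_atLeastAtMost[OF elim])
        (auto intro: has_field_derivative_at_within P contq
              simp: has_real_derivative_iff_has_vector_derivative[symmetric])
    moreover have "(\<lambda>x. indicator {..y} x *\<^sub>R (indicator {0..} x *\<^sub>R q x)) = (\<lambda>x. indicator {0..y} x *\<^sub>R q x)"
      by (auto simp: indicator_def)
    ultimately show ?case by (simp only: P_def)
  qed
  ultimately have limP: "(P \<longlongrightarrow> 0) at_top"
    by (rule Lim_transform_eventually)
  have pos: "std_normal_density x > 0" for x by (rule normal_density_pos) simp
  have nz: "std_normal_density x \<noteq> 0" for x using pos[of x] by linarith
  show thesis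
  proof
    fix w
    have "((\<lambda>x. P x / std_normal_density x) has_real_derivative
        (q w * std_normal_density w - P w * (- w * std_normal_density w))
          / (std_normal_density w * std_normal_density w)) (at w)"
      by (intro DERIV_divide P DERIV_std_normal_density nz)
    moreover have "(q w * std_normal_density w - P w * (- w * std_normal_density w))
          / (std_normal_density w * std_normal_density w) = w * (P w / std_normal_density w) + (g w - c)"
    proof -
      have "(x * y - z * (- w * y)) / (y * y) = w * (z / y) + x / y" if "y \<noteq> 0" for x y z :: real
        using that by (simp add: field_simps)
      from this[OF nz[of w]] show ?thesis by (simp add: q_def nz)
    qed
    ultimately show "((\<lambda>x. P x / std_normal_density x) has_real_derivative
        w * (P w / std_normal_density w) + (g w - c)) (at w)" by simp
  next
    fix w show "P (- w) / std_normal_density (- w) = - (P w / std_normal_density w)"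
      by (simp add: oddP normal_density_def)
  next
    show "((\<lambda>w. P w / std_normal_density w * std_normal_density w) \<longlongrightarrow> 0) at_top"
      using limP nz by simp
  qed
qed

text \<open>
  If \<open>f' - w f = g - c\<close>, then differentiating shows that \<open>f'\<close> and \<open>f''\<close> solve the same equation
  with right-hand sides \<open>f + g'\<close> and \<open>2 f' + g''\<close>.  So the comparison lemma can be applied three
  times in a row, each bound feeding the right-hand side of the next one.  On the half line
  \<open>w \<ge> 0\<close> the majorants are \<open>a (w + 4 / (1 + w))\<close> for \<open>f\<close>, \<open>a (3 + 8 / (1 + w))\<close> for \<open>f'\<close> and, away
  from \<open>0\<close>, \<open>b w + (24 a + b) / w\<close> for \<open>f''\<close>; the terms in \<open>1 / (1 + w)\<close> play the part of the Mills
  ratio, since \<open>V = 2 / (1 + w)\<close> satisfies \<open>w V - V' \<ge> 1\<close>.  Parity carries the bounds over to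
  \<open>w < 0\<close>.  The third derivative is then read off from the twice differentiated equation; at no
  point is \<open>g''\<close> integrated, so it may be discontinuous.
\<close>

lemma stein_solution_bounds:
  fixes g g' g'' :: "real \<Rightarrow> real"
  assumes even: "\<And>w. g (- w) = g w"
    and dg: "\<And>w. (g has_real_derivative g' w) (at w)"
    and dg': "\<And>w. (g' has_real_derivative g'' w) (at w)"
    and int: "integrable lborel (\<lambda>x. g x * std_normal_density x)"
    and c: "c = (LINT x|lborel. g x * std_normal_density x)"
    and a: "0 \<le> a" and b: "0 \<le> b"
    and bg: "\<And>w. \<bar>g w - c\<bar> \<le> a * (1 + w\<^sup>2)"
    and bg': "\<And>w. \<bar>g' w\<bar> \<le> 2 * a * \<bar>w\<bar>"
    and bg'': "\<And>w. \<bar>g'' w\<bar> \<le> 2 * a + b * w\<^sup>2"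
  obtains f f' f'' f''' where
    "\<And>w. (f has_real_derivative f' w) (at w)"
    "\<And>w. (f' has_real_derivative f'' w) (at w)"
    "\<And>w. (f'' has_real_derivative f''' w) (at w)"
    "\<And>w. f' w - w * f w = g w - c"
    "\<And>w. \<bar>f''' w\<bar> \<le> 48 * a + b + 2 * b * w\<^sup>2"
proof -
  have "continuous_on UNIV g" using dg DERIV_isCont by (auto intro!: continuous_at_imp_continuous_on)
  from stein_solution_exists[OF this even int c]
  obtain f where f: "\<And>w. (f has_real_derivative w * f w + (g w - c)) (at w)"
    and oddf: "\<And>w. f (- w) = - f w"
    and limf: "((\<lambda>w. f w * std_normal_density w) \<longlongrightarrow> 0) at_top" by blast
  define f' where "f' w = w * f w + (g w - c)" for w
  define f'' where "f'' w = f w + w * f' w + g' w" for w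
  define f''' where "f''' w = 2 * f' w + w * f'' w + g'' w" for w
  have df: "(f has_real_derivative f' w) (at w)" for w using f by (simp add: f'_def)
  have df': "(f' has_real_derivative f'' w) (at w)" for w
    unfolding f'_def f''_def using df[of w] dg[of w]
    by (auto intro!: derivative_eq_intros simp: f'_def)
  have df'': "(f'' has_real_derivative f''' w) (at w)" for w
    unfolding f''_def[abs_def] f'''_def using df[of w] df'[of w] dg'[of w]
    by (auto intro!: derivative_eq_intros simp: f''_def)
  have oddg': "g' (- w) = - g' w" for w
  proof -
    have "((\<lambda>x. g (- x)) has_real_derivative g' (- w) * - 1) (at w)"
      by (rule DERIV_chain2[OF dg]) (auto intro!: derivative_eq_intros)
    then show ?thesis using DERIV_unique[OF _ dg[of w]] even by fastforce
  qed
  have evenf': "f' (- w) = f' w" for w by (simp add: f'_def oddf even)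
  have oddf'': "f'' (- w) = - f'' w" for w by (simp add: f''_def oddf evenf' oddg')
  have bf: "\<bar>f w\<bar> \<le> a * (w + 4 / (1 + w))" if "0 \<le> w" for w
  proof (rule gaussian_comparison[where V = "\<lambda>w. a * (w + 4 / (1 + w))" and u' = f' and V' = "\<lambda>y. a * (1 - 4 / (1 + y)\<^sup>2)"])
    fix y assume "w \<le> y"
    with that have y: "0 \<le> y" by simp
    show "((\<lambda>w. a * (w + 4 / (1 + w))) has_real_derivative a * (1 - 4 / (1 + y)\<^sup>2)) (at y)"
      using y by (auto intro!: derivative_eq_intros simp: power2_eq_square)
    have "1 + y\<^sup>2 \<le> y * (y + 4 / (1 + y)) - (1 - 4 / (1 + y)\<^sup>2)"
      using y by (simp add: divide_simps) (simp add: power2_eq_square algebra_simps)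
    from mult_left_mono[OF this a]
    have "a * (1 + y\<^sup>2) \<le> y * (a * (y + 4 / (1 + y))) - a * (1 - 4 / (1 + y)\<^sup>2)"
      by (simp add: algebra_simps)
    then show "\<bar>f' y - y * f y\<bar> \<le> y * (a * (y + 4 / (1 + y))) - a * (1 - 4 / (1 + y)\<^sup>2)"
      using bg[of y] by (simp add: f'_def)
  next
    show "((\<lambda>y. a * (y + 4 / (1 + y)) * std_normal_density y) \<longlongrightarrow> 0) at_top"
      unfolding normal_density_def by real_asymp
  qed (use df limf in auto)
  have bf4: "\<bar>f w\<bar> \<le> a * (w + 4)" if "0 \<le> w" for w
  proof -
    have "4 / (1 + w) \<le> 4" using that by (simp add: divide_simps)
    then show ?thesis using bf[OF that] mult_left_mono[OF _ a, of "w + 4 / (1 + w)" "w + 4"] by simp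
  qed
  \<comment> \<open>The comparison for \<open>f'\<close> presupposes that \<open>f' \<phi>\<close> vanishes at infinity; a crude growth bound
    from the equation itself is enough for that.\<close>
  have limf': "((\<lambda>w. f' w * std_normal_density w) \<longlongrightarrow> 0) at_top"
  proof (rule quadratic_growth_times_density_tendsto_0[where C = "6 * a"])
    fix w :: real assume w: "1 \<le> w"
    have "\<bar>f' w\<bar> \<le> w * \<bar>f w\<bar> + \<bar>g w - c\<bar>"
      unfolding f'_def using w abs_triangle_ineq[of "w * f w"] by (simp add: abs_mult)
    also have "\<dots> \<le> w * (a * (w + 4)) + a * (1 + w\<^sup>2)"
      using w bf4[of w] bg[of w] by (intro add_mono mult_left_mono) auto
    also have "\<dots> = a * (w * (w + 4) + 1 + w\<^sup>2)" by (simp add: algebra_simps)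
    also have "\<dots> \<le> a * (6 * (1 + w\<^sup>2))"
    proof (rule mult_left_mono[OF _ a])
      show "w * (w + 4) + 1 + w\<^sup>2 \<le> 6 * (1 + w\<^sup>2)"
        using sum_squares_bound[of w 1] w by (simp add: power2_eq_square algebra_simps)
    qed
    finally show "\<bar>f' w\<bar> \<le> 6 * a * (1 + w\<^sup>2)" by (simp add: algebra_simps)
  qed
  have bf': "\<bar>f' w\<bar> \<le> a * (3 + 8 / (1 + w))" if "0 \<le> w" for w
  proof (rule gaussian_comparison[where V = "\<lambda>w. a * (3 + 8 / (1 + w))" and u' = f'' and V' = "\<lambda>y. a * (- 8 / (1 + y)\<^sup>2)"])
    fix y assume "w \<le> y"
    with that have y: "0 \<le> y" by simp
    show "((\<lambda>w. a * (3 + 8 / (1 + w))) has_real_derivative a * (- 8 / (1 + y)\<^sup>2)) (at y)"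
      using y by (auto intro!: derivative_eq_intros simp: power2_eq_square)
    have "3 * y + 4 \<le> y * (3 + 8 / (1 + y)) - (- 8 / (1 + y)\<^sup>2)"
      using y by (simp add: divide_simps) (simp add: power2_eq_square algebra_simps)
    from mult_left_mono[OF this a]
    have "a * (y + 4) + 2 * a * y \<le> y * (a * (3 + 8 / (1 + y))) - a * (- 8 / (1 + y)\<^sup>2)"
      by (simp add: algebra_simps)
    then show "\<bar>f'' y - y * f' y\<bar> \<le> y * (a * (3 + 8 / (1 + y))) - a * (- 8 / (1 + y)\<^sup>2)"
      using bf4[OF y] bg'[of y] y by (simp add: f''_def)
  next
    show "((\<lambda>y. a * (3 + 8 / (1 + y)) * std_normal_density y) \<longlongrightarrow> 0) at_top"
      unfolding normal_density_def by real_asymp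
  qed (use df' limf' in auto)
  have bf11: "\<bar>f' w\<bar> \<le> 11 * a" if "0 \<le> w" for w
  proof -
    have "8 / (1 + w) \<le> 8" using that by (simp add: divide_simps)
    then show ?thesis using bf'[OF that] mult_left_mono[OF _ a, of "3 + 8 / (1 + w)" "11"] by simp
  qed
  have limf'': "((\<lambda>w. f'' w * std_normal_density w) \<longlongrightarrow> 0) at_top"
  proof (rule quadratic_growth_times_density_tendsto_0[where C = "18 * a"])
    fix w :: real assume w: "1 \<le> w"
    have "\<bar>f'' w\<bar> \<le> \<bar>f w\<bar> + w * \<bar>f' w\<bar> + \<bar>g' w\<bar>"
      unfolding f''_def using w abs_triangle_ineq[of "f w + w * f' w" "g' w"]
        abs_triangle_ineq[of "f w" "w * f' w"] by (simp add: abs_mult)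
    also have "\<dots> \<le> a * (w + 4) + w * (11 * a) + 2 * a * w"
      using w bf4[of w] bg'[of w] bf11[of w] by (intro add_mono mult_left_mono) auto
    also have "\<dots> = a * (14 * w + 4)" by (simp add: algebra_simps)
    also have "\<dots> \<le> a * (18 * (1 + w\<^sup>2))"
    proof (rule mult_left_mono[OF _ a])
      show "14 * w + 4 \<le> 18 * (1 + w\<^sup>2)"
        using sum_squares_bound[of w 1] w by (simp add: power2_eq_square algebra_simps)
    qed
    finally show "\<bar>f'' w\<bar> \<le> 18 * a * (1 + w\<^sup>2)" by (simp add: algebra_simps)
  qed
  have rhs: "\<bar>2 * f' w + g'' w\<bar> \<le> 24 * a + b * w\<^sup>2" if "0 \<le> w" for w
    using bf11[OF that] bg''[of w] by linarith
  have bf'': "w * \<bar>f'' w\<bar> \<le> 24 * a + b + b * w\<^sup>2" if "0 < w" for w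
  proof -
    have "\<bar>f'' w\<bar> \<le> b * w + (24 * a + b) / w"
    proof (rule gaussian_comparison[where V = "\<lambda>w. b * w + (24 * a + b) / w" and u' = f''' and V' = "\<lambda>y. b - (24 * a + b) / y\<^sup>2"])
      fix y assume "w \<le> y"
      with that have y: "0 < y" by simp
      show "((\<lambda>w. b * w + (24 * a + b) / w) has_real_derivative b - (24 * a + b) / y\<^sup>2) (at y)"
        using y by (auto intro!: derivative_eq_intros simp: power2_eq_square minus_divide_left)
      have "24 * a + b * y\<^sup>2 \<le> 24 * a + b * y\<^sup>2 + (24 * a + b) / y\<^sup>2"
        using y a b by simp
      also have "\<dots> = y * (b * y + (24 * a + b) / y) - (b - (24 * a + b) / y\<^sup>2)"
        using y by (simp add: field_simps power2_eq_square)
      finally show "\<bar>f''' y - y * f'' y\<bar> \<le> y * (b * y + (24 * a + b) / y) - (b - (24 * a + b) / y\<^sup>2)"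
        using rhs[of y] y by (simp add: f'''_def)
    next
      show "((\<lambda>y. (b * y + (24 * a + b) / y) * std_normal_density y) \<longlongrightarrow> 0) at_top"
        unfolding normal_density_def by real_asymp
    qed (use df'' limf'' in auto)
    from mult_left_mono[OF this, of w]
    have "w * \<bar>f'' w\<bar> \<le> w * (b * w + (24 * a + b) / w)" using that by simp
    also have "\<dots> = 24 * a + b + b * w\<^sup>2"
      using that by (simp add: field_simps power2_eq_square)
    finally show ?thesis .
  qed
  have "\<bar>f''' w\<bar> \<le> 48 * a + b + 2 * b * w\<^sup>2" for w
  proof -
    have 1: "\<bar>2 * f' w + g'' w\<bar> \<le> 24 * a + b * w\<^sup>2"
    proof -
      have "\<bar>f' w\<bar> \<le> 11 * a"
        using bf11[of "\<bar>w\<bar>"] evenf'[of w] by (cases "0 \<le> w") auto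
      then show ?thesis using bg''[of w] by linarith
    qed
    have 2: "\<bar>w * f'' w\<bar> \<le> 24 * a + b + b * w\<^sup>2"
    proof (cases "w = 0")
      case True then show ?thesis using a b by simp
    next
      case False
      then show ?thesis using bf''[of "\<bar>w\<bar>"] oddf''[of w]
        by (cases "0 \<le> w") (auto simp: abs_mult)
    qed
    show ?thesis using 1 2 unfolding f'''_def by linarith
  qed
  then show thesis using that[OF df df' df''] by (simp add: f'_def)
qed

section \<open>Trapezoidal errors and sums of independent signs\<close>

text \<open>
  The left-hand side is the error of the trapezoidal rule for the mean of \<open>f'\<close> over
  \<open>[w - d, w + d]\<close>, hence of second order in \<open>d\<close>.
\<close>

lemma trapezoid_defect:
  fixes f f' f'' f''' :: "real \<Rightarrow> real"
  assumes df: "\<And>w. (f has_real_derivative f' w) (at w)"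
    and df': "\<And>w. (f' has_real_derivative f'' w) (at w)"
    and df'': "\<And>w. (f'' has_real_derivative f''' w) (at w)"
    and d: "0 < d"
    and K: "\<And>y. \<bar>y - w\<bar> \<le> d \<Longrightarrow> \<bar>f''' y\<bar> \<le> K"
  shows "\<bar>(f' (w + d) + f' (w - d)) / 2 - (f (w + d) - f (w - d)) / (2 * d)\<bar> \<le> K * d\<^sup>2"
proof -
  have K0: "0 \<le> K" using K[of w] d by auto
  \<comment> \<open>As a function of the radius \<open>s\<close>, the error times \<open>2 s\<close> vanishes at \<open>0\<close>, and in its derivative
    the values of \<open>f'\<close> cancel.\<close>
  define T where "T s = s * (f' (w + s) + f' (w - s)) - (f (w + s) - f (w - s))" for s
  have dT: "(T has_real_derivative s * (f'' (w + s) - f'' (w - s))) (at s)" for s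
    unfolding T_def
    by (rule derivative_eq_intros DERIV_chain2[OF df] DERIV_chain2[OF df'] refl
        | simp add: algebra_simps)+
  obtain s where s: "0 < s" "s < d" "T d - T 0 = (d - 0) * (s * (f'' (w + s) - f'' (w - s)))"
    using MVT2[OF d dT] by blast
  obtain z where z: "w - s < z" "z < w + s" "f'' (w + s) - f'' (w - s) = ((w + s) - (w - s)) * f''' z"
    using MVT2[of "w - s" "w + s" f'' f'''] df'' s by auto
  have "\<bar>T d\<bar> = d * (s * (2 * s * \<bar>f''' z\<bar>))"
    using s z(3) d by (simp add: T_def abs_mult)
  also have "\<dots> \<le> d * (d * (2 * d * K))"
    using s z d K0 K[of z] by (intro mult_mono mult_left_mono) auto
  finally have "\<bar>T d\<bar> \<le> 2 * d * (K * d\<^sup>2)" by (simp add: power2_eq_square algebra_simps)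
  moreover have "(f' (w + d) + f' (w - d)) / 2 - (f (w + d) - f (w - d)) / (2 * d) = T d / (2 * d)"
    using d by (simp add: T_def field_simps)
  ultimately show ?thesis
    using d by (simp only: abs_divide) (simp add: pos_divide_le_eq algebra_simps)
qed

text \<open>
  The expectation of \<open>\<phi>\<close> at a sum of \<open>n\<close> independent symmetric signs, obtained by conditioning on
  one sign at a time.  In this form linearity and monotonicity hold for all functions, without
  any measurability or integrability.
\<close>
primrec rademacher_mean :: "nat \<Rightarrow> (real \<Rightarrow> real) \<Rightarrow> real" where
  "rademacher_mean 0 \<phi> = \<phi> 0"
| "rademacher_mean (Suc n) \<phi> =
     (rademacher_mean n (\<lambda>s. \<phi> (s + 1)) + rademacher_mean n (\<lambda>s. \<phi> (s - 1))) / 2"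

lemma rademacher_mean_add:
  "rademacher_mean n (\<lambda>s. \<phi> s + \<psi> s) = rademacher_mean n \<phi> + rademacher_mean n \<psi>"
  by (induction n arbitrary: \<phi> \<psi>) (simp_all add: field_simps)

lemma rademacher_mean_cmult:
  "rademacher_mean n (\<lambda>s. k * \<phi> s) = k * rademacher_mean n \<phi>"
  by (induction n arbitrary: \<phi>) (simp_all add: field_simps)

lemma rademacher_mean_diff:
  "rademacher_mean n (\<lambda>s. \<phi> s - \<psi> s) = rademacher_mean n \<phi> - rademacher_mean n \<psi>"
  using rademacher_mean_add[of n \<phi> "\<lambda>s. - 1 * \<psi> s"] rademacher_mean_cmult[of n "- 1" \<psi>] by simp

lemma rademacher_mean_const: "rademacher_mean n (\<lambda>s. k) = k"
  by (induction n) simp_all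

lemma rademacher_mean_mono:
  "(\<And>s. \<phi> s \<le> \<psi> s) \<Longrightarrow> rademacher_mean n \<phi> \<le> rademacher_mean n \<psi>"
  by (induction n arbitrary: \<phi> \<psi>) (simp_all add: add_mono)

lemma rademacher_mean_abs:
  assumes "\<And>s. \<bar>\<phi> s\<bar> \<le> \<psi> s"
  shows "\<bar>rademacher_mean n \<phi>\<bar> \<le> rademacher_mean n \<psi>"
proof -
  have "\<phi> s \<le> \<psi> s" "- 1 * \<phi> s \<le> \<psi> s" for s using assms[of s] by auto
  then show ?thesis
    using rademacher_mean_mono[of \<phi> \<psi> n] rademacher_mean_mono[of "\<lambda>s. - 1 * \<phi> s" \<psi> n]
    unfolding rademacher_mean_cmult by (auto simp: abs_if)
qed

lemma rademacher_mean_square: "rademacher_mean n (\<lambda>s. s\<^sup>2) = real n"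
proof (induction n)
  case (Suc n)
  have "rademacher_mean (Suc n) (\<lambda>s. s\<^sup>2)
      = 1/2 * rademacher_mean n (\<lambda>s. (s + 1)\<^sup>2 + (s - 1)\<^sup>2)"
    by (simp add: rademacher_mean_add)
  also have "(\<lambda>s::real. (s + 1)\<^sup>2 + (s - 1)\<^sup>2) = (\<lambda>s. 2 * s\<^sup>2 + 2)"
    by (auto simp: power2_eq_square algebra_simps)
  finally show ?case
    by (simp add: rademacher_mean_add rademacher_mean_cmult rademacher_mean_const Suc)
qed simp

text \<open>
  By symmetry each of the \<open>n + 1\<close> signs contributes equally to the left-hand side, and averaging
  over that sign turns multiplication by it into a symmetric difference of the remaining sum.
  This is the discrete counterpart of Gaussian integration by parts.
\<close>

lemma rademacher_mean_stein_identity: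
  "rademacher_mean (Suc n) (\<lambda>s. s * \<phi> s)
     = real (Suc n) * rademacher_mean n (\<lambda>s. (\<phi> (s + 1) - \<phi> (s - 1)) / 2)"
proof (induction n arbitrary: \<phi>)
  case (Suc n)
  define \<psi> where "\<psi> s = (\<phi> (s + 1) + \<phi> (s - 1)) / 2" for s
  have "rademacher_mean (Suc (Suc n)) (\<lambda>s. s * \<phi> s)
      = 1/2 * rademacher_mean (Suc n) (\<lambda>s. (s + 1) * \<phi> (s + 1) + (s - 1) * \<phi> (s - 1))"
    unfolding rademacher_mean_add by simp
  also have "\<dots> = rademacher_mean (Suc n) (\<lambda>s. s * \<psi> s + (\<phi> (s + 1) - \<phi> (s - 1)) / 2)"
    unfolding rademacher_mean_cmult[symmetric]
    by (rule arg_cong[where f = "rademacher_mean (Suc n)"]) (auto simp: \<psi>_def field_simps)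
  also have "\<dots> = real (Suc n) * rademacher_mean n (\<lambda>s. (\<psi> (s + 1) - \<psi> (s - 1)) / 2)
      + rademacher_mean (Suc n) (\<lambda>s. (\<phi> (s + 1) - \<phi> (s - 1)) / 2)"
    unfolding rademacher_mean_add Suc.IH ..
  also have "rademacher_mean n (\<lambda>s. (\<psi> (s + 1) - \<psi> (s - 1)) / 2)
      = 1/2 * rademacher_mean n (\<lambda>s. (\<phi> (s + 1 + 1) - \<phi> (s + 1 - 1)) / 2 + (\<phi> (s - 1 + 1) - \<phi> (s - 1 - 1)) / 2)"
    unfolding rademacher_mean_cmult[symmetric]
    by (rule arg_cong[where f = "rademacher_mean n"]) (auto simp: \<psi>_def field_simps)
  also have "\<dots> = rademacher_mean (Suc n) (\<lambda>s. (\<phi> (s + 1) - \<phi> (s - 1)) / 2)"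
    unfolding rademacher_mean_add by simp
  finally show ?case by (simp only: of_nat_Suc algebra_simps)
qed simp

section \<open>The rate for smooth test functions\<close>

text \<open>
  Both claims come from the majorant \<open>A x\<^sup>2\<close> of \<open>|h (x\<^sup>2) - h 0|\<close>, the second one because the
  standard normal law has second moment \<open>1\<close>.
\<close>

lemma integrable_square_times_density:
  fixes h :: "real \<Rightarrow> real"
  assumes cont: "continuous_on {0..} h" and A: "\<And>x. 0 \<le> x \<Longrightarrow> \<bar>h x - h 0\<bar> \<le> A * x"
  shows "integrable lborel (\<lambda>x. h (x\<^sup>2) * std_normal_density x)"
    and "\<bar>(LINT x|lborel. h (x\<^sup>2) * std_normal_density x) - h 0\<bar> \<le> A"
proof -
  have m2: "integrable lborel (\<lambda>x. std_normal_density x * x\<^sup>2)"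
    "(LINT x|lborel. std_normal_density x * x\<^sup>2) = 1"
    using integral_std_normal_moment_even[of 1] integrable_std_normal_moment[of 2] by simp_all
  have "continuous_on UNIV (\<lambda>x::real. h (x\<^sup>2))"
    by (rule continuous_on_compose2[OF cont]) (auto intro!: continuous_intros)
  then have [measurable]: "(\<lambda>x. h (x\<^sup>2)) \<in> borel_measurable borel"
    by (rule borel_measurable_continuous_onI)
  have bound: "\<bar>(h (x\<^sup>2) - h 0) * std_normal_density x\<bar> \<le> A * (std_normal_density x * x\<^sup>2)" for x
  proof -
    have "\<bar>h (x\<^sup>2) - h 0\<bar> * std_normal_density x \<le> (A * x\<^sup>2) * std_normal_density x"
      using A[of "x\<^sup>2"] by (intro mult_right_mono) auto
    then show ?thesis by (simp add: abs_mult mult_ac)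
  qed
  have i2: "integrable lborel (\<lambda>x. A * (std_normal_density x * x\<^sup>2))"
    using m2 by (intro integrable_mult_right) auto
  have i1: "integrable lborel (\<lambda>x. (h (x\<^sup>2) - h 0) * std_normal_density x)"
    by (rule Bochner_Integration.integrable_bound[OF i2])
      (use bound in \<open>auto intro: order_trans[OF _ abs_ge_self]\<close>)
  have "integrable lborel (\<lambda>x. (h (x\<^sup>2) - h 0) * std_normal_density x + h 0 * std_normal_density x)"
    using i1 std_normal_density_mass by auto
  then show int: "integrable lborel (\<lambda>x. h (x\<^sup>2) * std_normal_density x)"
    by (simp add: algebra_simps)
  have "(LINT x|lborel. h (x\<^sup>2) * std_normal_density x) - h 0
      = (LINT x|lborel. (h (x\<^sup>2) - h 0) * std_normal_density x)"
    using int std_normal_density_mass by (simp add: left_diff_distrib)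
  also have "\<bar>\<dots>\<bar> \<le> (LINT x|lborel. \<bar>(h (x\<^sup>2) - h 0) * std_normal_density x\<bar>)"
    by (rule integral_abs_bound)
  also have "\<dots> \<le> (LINT x|lborel. A * (std_normal_density x * x\<^sup>2))"
    using i1 i2 bound by (intro integral_mono) auto
  also have "\<dots> = A" using m2 by simp
  finally show "\<bar>(LINT x|lborel. h (x\<^sup>2) * std_normal_density x) - h 0\<bar> \<le> A" .
qed

lemma square_composition_derivatives:
  fixes h h' h'' :: "real \<Rightarrow> real"
  assumes dh: "\<And>x. 0 \<le> x \<Longrightarrow> (h has_real_derivative h' x) (at x within {0..})"
    and dh': "\<And>x. 0 \<le> x \<Longrightarrow> (h' has_real_derivative h'' x) (at x within {0..})"
  shows "((\<lambda>w. h (w\<^sup>2)) has_real_derivative 2 * w * h' (w\<^sup>2)) (at w)"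
    and "((\<lambda>w. 2 * w * h' (w\<^sup>2)) has_real_derivative 2 * h' (w\<^sup>2) + 4 * w\<^sup>2 * h'' (w\<^sup>2)) (at w)"
proof -
  have chain: "((\<lambda>w. k (w\<^sup>2)) has_real_derivative k' * (2 * w)) (at w)"
    if "(k has_real_derivative k') (at (w\<^sup>2) within {0..})" for k :: "real \<Rightarrow> real" and k'
  proof -
    have "(k has_real_derivative k') (at (w\<^sup>2) within range (\<lambda>w. w\<^sup>2))"
      by (rule has_field_derivative_subset[OF that]) auto
    moreover have "((\<lambda>w. w\<^sup>2) has_real_derivative 2 * w) (at w)"
      by (auto intro!: derivative_eq_intros)
    ultimately show ?thesis
      using DERIV_image_chain[of k k' "\<lambda>w. w\<^sup>2" w UNIV "2 * w"] by (simp add: o_def)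
  qed
  show "((\<lambda>w. h (w\<^sup>2)) has_real_derivative 2 * w * h' (w\<^sup>2)) (at w)"
    using chain[OF dh] by (simp add: mult_ac)
  have "((\<lambda>w. 2 * w * h' (w\<^sup>2)) has_real_derivative 2 * h' (w\<^sup>2) + (h'' (w\<^sup>2) * (2 * w)) * (2 * w)) (at w)"
    by (rule DERIV_mult[OF _ chain[OF dh']]) (auto intro!: derivative_eq_intros)
  then show "((\<lambda>w. 2 * w * h' (w\<^sup>2)) has_real_derivative 2 * h' (w\<^sup>2) + 4 * w\<^sup>2 * h'' (w\<^sup>2)) (at w)"
    by (simp add: power2_eq_square mult_ac)
qed

lemma growth_from_derivative:
  fixes h h' :: "real \<Rightarrow> real"
  assumes dh: "\<And>x. 0 \<le> x \<Longrightarrow> (h has_real_derivative h' x) (at x within {0..})"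
    and A: "\<And>x. 0 \<le> x \<Longrightarrow> \<bar>h' x\<bar> \<le> A" and x: "0 \<le> x"
  shows "\<bar>h x - h 0\<bar> \<le> A * x"
  using field_differentiable_bound[of "{0..}" h h' A x 0] assms by auto

text \<open>
  Put \<open>W = d S\<close> with \<open>S\<close> the sum of \<open>n\<close> signs and \<open>d = 1 / \<surd>n\<close>.  By the Stein equation the
  difference to be bounded is the mean of \<open>f' W - W f W\<close>.  Isolating one sign, the first term
  averages \<open>f'\<close> over the two ends of an interval of radius \<open>d\<close> around the rest of the sum, and the
  second, by the identity for signs, averages \<open>f'\<close> over the whole interval.  The difference is a
  trapezoidal error, of order \<open>d\<^sup>2 = 1 / n\<close> because the third derivative of \<open>f\<close> grows at most
  quadratically.
\<close>

theorem rademacher_square_smooth_bound: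
  fixes h h' h'' :: "real \<Rightarrow> real"
  assumes dh: "\<And>x. 0 \<le> x \<Longrightarrow> (h has_real_derivative h' x) (at x within {0..})"
    and dh': "\<And>x. 0 \<le> x \<Longrightarrow> (h' has_real_derivative h'' x) (at x within {0..})"
    and A: "\<And>x. 0 \<le> x \<Longrightarrow> \<bar>h' x\<bar> \<le> A" and B: "\<And>x. 0 \<le> x \<Longrightarrow> \<bar>h'' x\<bar> \<le> B"
    and n: "1 \<le> n"
  shows "\<bar>rademacher_mean n (\<lambda>s. h (s\<^sup>2 / real n)) - (LINT x|lborel. h (x\<^sup>2) * std_normal_density x)\<bar>
      \<le> (48 * A + 20 * B) / real n"
proof -
  define c where "c = (LINT x|lborel. h (x\<^sup>2) * std_normal_density x)"
  have A0: "0 \<le> A" and B0: "0 \<le> B" using A[of 0] B[of 0] by auto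
  have cont: "continuous_on {0..} h"
    using dh by (auto intro!: DERIV_continuous_on)
  note growth = growth_from_derivative[OF dh A]
  note intg = integrable_square_times_density[OF cont growth]
  obtain f f' f'' f''' where
    df: "\<And>w. (f has_real_derivative f' w) (at w)" and
    df': "\<And>w. (f' has_real_derivative f'' w) (at w)" and
    df'': "\<And>w. (f'' has_real_derivative f''' w) (at w)" and
    stein: "\<And>w. f' w - w * f w = h (w\<^sup>2) - c" and
    bound: "\<And>w. \<bar>f''' w\<bar> \<le> 48 * A + 4 * B + 2 * (4 * B) * w\<^sup>2"
  proof (rule stein_solution_bounds[where a = A and b = "4 * B" and c = c])
    show "((\<lambda>w. h (w\<^sup>2)) has_real_derivative 2 * w * h' (w\<^sup>2)) (at w)" for w
      by (rule square_composition_derivatives(1)[OF dh dh'])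
    show "((\<lambda>w. 2 * w * h' (w\<^sup>2)) has_real_derivative 2 * h' (w\<^sup>2) + 4 * w\<^sup>2 * h'' (w\<^sup>2)) (at w)" for w
      by (rule square_composition_derivatives(2)[OF dh dh'])
    show "\<bar>h (w\<^sup>2) - c\<bar> \<le> A * (1 + w\<^sup>2)" for w
      using growth[of "w\<^sup>2"] intg(2) unfolding c_def[symmetric] by (simp add: algebra_simps)
    show "\<bar>2 * w * h' (w\<^sup>2)\<bar> \<le> 2 * A * \<bar>w\<bar>" for w
      using mult_right_mono[OF A[of "w\<^sup>2"], of "\<bar>w\<bar>"] by (simp add: abs_mult mult_ac)
    show "\<bar>2 * h' (w\<^sup>2) + 4 * w\<^sup>2 * h'' (w\<^sup>2)\<bar> \<le> 2 * A + 4 * B * w\<^sup>2" for w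
    proof -
      have "\<bar>2 * h' (w\<^sup>2) + 4 * w\<^sup>2 * h'' (w\<^sup>2)\<bar> \<le> 2 * \<bar>h' (w\<^sup>2)\<bar> + 4 * w\<^sup>2 * \<bar>h'' (w\<^sup>2)\<bar>"
        using abs_triangle_ineq[of "2 * h' (w\<^sup>2)" "4 * w\<^sup>2 * h'' (w\<^sup>2)"] by (simp add: abs_mult)
      also have "\<dots> \<le> 2 * A + 4 * w\<^sup>2 * B"
        using A[of "w\<^sup>2"] B[of "w\<^sup>2"] by (intro add_mono mult_left_mono) auto
      finally show ?thesis by (simp add: mult_ac)
    qed
  qed (use A0 B0 intg(1) c_def in auto)
  obtain m where m: "n = Suc m" using n by (cases n) auto
  define d where "d = 1 / sqrt (real n)"
  have d: "0 < d" "d\<^sup>2 * real n = 1" "d\<^sup>2 = 1 / real n" using n by (auto simp: d_def power_divide)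
  define defect where "defect w = (f' (w + d) + f' (w - d)) / 2 - (f (w + d) - f (w - d)) / (2 * d)" for w
  have "rademacher_mean n (\<lambda>s. h (s\<^sup>2 / real n)) - c = rademacher_mean n (\<lambda>s. h ((d * s)\<^sup>2) - c)"
    by (simp add: rademacher_mean_diff rademacher_mean_const power_mult_distrib d(3))
  also have "\<dots> = rademacher_mean n (\<lambda>s. f' (d * s)) - rademacher_mean n (\<lambda>s. s * (d * f (d * s)))"
    unfolding stein[symmetric] rademacher_mean_diff by (simp add: mult_ac)
  also have "rademacher_mean n (\<lambda>s. s * (d * f (d * s)))
      = real n * rademacher_mean m (\<lambda>s. (d * f (d * (s + 1)) - d * f (d * (s - 1))) / 2)"
    unfolding m by (rule rademacher_mean_stein_identity)
  also have "\<dots> = rademacher_mean m (\<lambda>s. (f (d * s + d) - f (d * s - d)) / (2 * d))"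
    unfolding rademacher_mean_cmult[symmetric]
  proof (rule arg_cong[where f = "rademacher_mean m"], rule ext)
    fix s
    have "real n * d = 1 / d" using d by (simp add: field_simps power2_eq_square)
    then have "real n * ((d * x - d * y) / 2) = (x - y) / (2 * d)" for x y
      by (metis (no_types, opaque_lifting) divide_divide_eq_left mult.assoc mult.commute mult_1 right_diff_distrib times_divide_eq_left times_divide_eq_right)
    from this[of "f (d * s + d)" "f (d * s - d)"]
    show "real n * ((d * f (d * (s + 1)) - d * f (d * (s - 1))) / 2)
        = (f (d * s + d) - f (d * s - d)) / (2 * d)"
      by (simp only: distrib_left[of d s 1] right_diff_distrib[of d s 1] mult_1_right)
  qed
  also have "rademacher_mean n (\<lambda>s. f' (d * s)) = rademacher_mean m (\<lambda>s. (f' (d * s + d) + f' (d * s - d)) / 2)"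
  proof -
    have "rademacher_mean n (\<lambda>s. f' (d * s)) = 1/2 * rademacher_mean m (\<lambda>s. f' (d * (s + 1)) + f' (d * (s - 1)))"
      unfolding m rademacher_mean_add by simp
    also have "\<dots> = rademacher_mean m (\<lambda>s. (f' (d * s + d) + f' (d * s - d)) / 2)"
      unfolding rademacher_mean_cmult[symmetric]
      by (simp add: distrib_left right_diff_distrib add_divide_distrib)
    finally show ?thesis .
  qed
  finally have mean_defect:
    "rademacher_mean n (\<lambda>s. h (s\<^sup>2 / real n)) - c = rademacher_mean m (\<lambda>s. defect (d * s))"
    by (simp add: defect_def rademacher_mean_diff)
  have "\<bar>rademacher_mean m (\<lambda>s. defect (d * s))\<bar> \<le> rademacher_mean m (\<lambda>s. (48 * A + 4 * B + 16 * B * d\<^sup>2) * d\<^sup>2 + (16 * B * d\<^sup>2 * d\<^sup>2) * s\<^sup>2)"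
  proof (rule rademacher_mean_abs)
    fix s
    \<comment> \<open>The bound on \<open>f'''\<close> is needed on the whole interval, where \<open>y\<^sup>2\<close> is at most
      \<open>2 (d s)\<^sup>2 + 2 d\<^sup>2\<close>; the mean of this over the remaining \<open>n - 1\<close> signs is exactly \<open>2\<close>.\<close>
    have "\<bar>defect (d * s)\<bar> \<le> (48 * A + 4 * B + 8 * B * (2 * (d * s)\<^sup>2 + 2 * d\<^sup>2)) * d\<^sup>2"
      unfolding defect_def
    proof (rule trapezoid_defect[OF df df' df'' d(1)])
      fix y assume y: "\<bar>y - d * s\<bar> \<le> d"
      have "(y - d * s)\<^sup>2 \<le> d\<^sup>2" using y d(1) by (simp add: abs_le_square_iff[symmetric])
      moreover have "y\<^sup>2 \<le> 2 * (d * s)\<^sup>2 + 2 * (y - d * s)\<^sup>2"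
        using sum_squares_bound[of "d * s" "y - d * s"] by (simp add: power2_eq_square algebra_simps)
      ultimately have "y\<^sup>2 \<le> 2 * (d * s)\<^sup>2 + 2 * d\<^sup>2" by linarith
      then have "8 * B * y\<^sup>2 \<le> 8 * B * (2 * (d * s)\<^sup>2 + 2 * d\<^sup>2)"
        using B0 by (intro mult_left_mono) auto
      then show "\<bar>f''' y\<bar> \<le> 48 * A + 4 * B + 8 * B * (2 * (d * s)\<^sup>2 + 2 * d\<^sup>2)"
        using bound[of y] by simp
    qed
    then show "\<bar>defect (d * s)\<bar> \<le> (48 * A + 4 * B + 16 * B * d\<^sup>2) * d\<^sup>2 + (16 * B * d\<^sup>2 * d\<^sup>2) * s\<^sup>2"
      by (simp add: algebra_simps power_mult_distrib)
  qed
  also have "\<dots> = (48 * A + 4 * B + 16 * B * (d\<^sup>2 * real n)) * d\<^sup>2"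
    unfolding rademacher_mean_add rademacher_mean_cmult rademacher_mean_const rademacher_mean_square m
    by (simp add: algebra_simps)
  also have "\<dots> = (48 * A + 20 * B) / real n"
    unfolding d(2) by (simp add: d(3))
  finally show ?thesis unfolding mean_defect[symmetric] c_def .
qed

section \<open>The rate for Lipschitz test functions\<close>

text \<open>
  The smoothed function is the second difference quotient with step \<open>e\<close> of a second antiderivative
  of \<open>h\<close>.  Its first two derivatives are second difference quotients of a first antiderivative and
  of \<open>h\<close> itself, and the mean value theorem evaluates it as a value of \<open>h\<close> at a point of
  \<open>(x, x + 2 e)\<close>.
\<close>

lemma lipschitz_smoothing:
  fixes h :: "real \<Rightarrow> real"
  assumes lip: "1-lipschitz_on UNIV h" and e: "0 < e"
  obtains k k' k'' where
    "\<And>x. (k has_real_derivative k' x) (at x)"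
    "\<And>x. (k' has_real_derivative k'' x) (at x)"
    "\<And>x. \<bar>k' x\<bar> \<le> 1" "\<And>x. \<bar>k'' x\<bar> \<le> 2 / e" "\<And>x. \<bar>k x - h x\<bar> \<le> 2 * e"
proof -
  have L: "\<bar>h x - h y\<bar> \<le> \<bar>x - y\<bar>" for x y
    using lipschitz_onD[OF lip, of x y] by (simp add: dist_real_def)
  have "continuous_on UNIV h" using lip by (rule lipschitz_on_continuous_on)
  then obtain H where H: "\<And>x. (H has_real_derivative h x) (at x)"
    using continuous_has_antiderivative by blast
  then have "continuous_on UNIV H" by (auto intro!: DERIV_continuous_on)
  then obtain G where G: "\<And>x. (G has_real_derivative H x) (at x)"
    using continuous_has_antiderivative by blast
  define D where "D F x = (F (x + 2 * e) - F (x + e) - (F (x + e) - F x)) / e\<^sup>2" for F :: "real \<Rightarrow> real" and x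
  have shift: "((\<lambda>x. F (x + t)) has_real_derivative F' (x + t)) (at x)"
    if "\<And>x. (F has_real_derivative F' x) (at x)" for F F' :: "real \<Rightarrow> real" and t x
    using DERIV_shift[of F "F' (x + t)" x t] that by blast
  have dD: "(D F has_real_derivative D F' x) (at x)"
    if F: "\<And>x. (F has_real_derivative F' x) (at x)" for F F' :: "real \<Rightarrow> real" and x
    unfolding D_def[abs_def] by (intro DERIV_cdivide DERIV_diff shift F)
  have mvt: "\<exists>z. x < z \<and> z < x + e \<and> D F x = (F' (z + e) - F' z) / e"
    if F: "\<And>x. (F has_real_derivative F' x) (at x)" for F F' :: "real \<Rightarrow> real" and x
  proof -
    have "x < x + e" using e by simp
    from MVT2[OF this, of "\<lambda>x. F (x + e) - F x" "\<lambda>x. F' (x + e) - F' x"]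
    obtain z where "x < z" "z < x + e"
      "(F (x + e + e) - F (x + e)) - (F (x + e) - F x) = (x + e - x) * (F' (z + e) - F' z)"
      using DERIV_diff[OF shift[OF F] F] by auto
    then show ?thesis
      using e by (intro exI[of _ z]) (simp add: D_def power2_eq_square add.assoc)
  qed
  show thesis
  proof
    show "(D G has_real_derivative D H x) (at x)" for x by (rule dD[OF G])
    show "(D H has_real_derivative D h x) (at x)" for x by (rule dD[OF H])
    show "\<bar>D H x\<bar> \<le> 1" for x
    proof -
      obtain z where z: "D H x = (h (z + e) - h z) / e" using mvt[OF H] by blast
      show ?thesis unfolding z using L[of "z + e" z] e by simp
    qed
    show "\<bar>D h x\<bar> \<le> 2 / e" for x
    proof -
      have "\<bar>h (x + 2 * e) - h (x + e) - (h (x + e) - h x)\<bar> \<le> 2 * e"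
        using L[of "x + 2 * e" "x + e"] L[of "x + e" x] e by auto
      then have "\<bar>D h x\<bar> \<le> 2 * e / e\<^sup>2" unfolding D_def abs_divide using e by (simp add: divide_right_mono)
      then show ?thesis using e by (simp add: power2_eq_square)
    qed
    show "\<bar>D G x - h x\<bar> \<le> 2 * e" for x
    proof -
      obtain z where z: "x < z" "z < x + e" "D G x = (H (z + e) - H z) / e" using mvt[OF G] by blast
      obtain y where y: "z < y" "y < z + e" "H (z + e) - H z = (z + e - z) * h y"
        using MVT2[of z "z + e" H h] H e by auto
      have "D G x = h y" using z y e by simp
      then show ?thesis using L[of y x] y z by auto
    qed
  qed
qed

text \<open>
  Smoothing at scale \<open>e\<close> costs \<open>2 e\<close> on each side and produces a second derivative of order
  \<open>1 / e\<close>, to which the smooth bound assigns an error of order \<open>1 / (n e)\<close>.  The two costs balance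
  at \<open>e = 1 / \<surd>n\<close>.
\<close>

theorem rademacher_square_lipschitz_bound:
  fixes h :: "real \<Rightarrow> real"
  assumes lip: "1-lipschitz_on UNIV h" and n: "1 \<le> n"
  shows "\<bar>rademacher_mean n (\<lambda>s. h (s\<^sup>2 / real n)) - (LINT x|lborel. h (x\<^sup>2) * std_normal_density x)\<bar>
      \<le> 1 / sqrt (real n) * (44 + 48 / sqrt (real n))"
proof -
  define e where "e = 1 / sqrt (real n)"
  have e: "0 < e" "1 / real n = e * e" using n by (simp_all add: e_def)
  obtain k k' k'' where
    dk: "\<And>x. (k has_real_derivative k' x) (at x)" and
    dk': "\<And>x. (k' has_real_derivative k'' x) (at x)" and
    k': "\<And>x. \<bar>k' x\<bar> \<le> 1" and k'': "\<And>x. \<bar>k'' x\<bar> \<le> 2 / e" and kh: "\<And>x. \<bar>k x - h x\<bar> \<le> 2 * e"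
    using lipschitz_smoothing[OF lip e(1)] by blast
  have conth: "continuous_on {0..} h"
    using lipschitz_on_continuous_on[OF lip] continuous_on_subset by blast
  have growthh: "\<bar>h x - h 0\<bar> \<le> 1 * x" if "0 \<le> x" for x
    using lipschitz_onD[OF lip, of x 0] that by (simp add: dist_real_def)
  have contk: "continuous_on {0..} k"
    by (rule DERIV_continuous_on[where D = k']) (rule has_field_derivative_at_within[OF dk])
  have growthk: "\<bar>k x - k 0\<bar> \<le> 1 * x" if "0 \<le> x" for x
    by (rule growth_from_derivative[where h' = k']) (use dk k' that in \<open>auto intro: has_field_derivative_at_within\<close>)
  note inth = integrable_square_times_density(1)[OF conth growthh]
  note intk = integrable_square_times_density(1)[OF contk growthk]
  have 1: "\<bar>rademacher_mean n (\<lambda>s. k (s\<^sup>2 / real n)) - rademacher_mean n (\<lambda>s. h (s\<^sup>2 / real n))\<bar> \<le> 2 * e"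
    using rademacher_mean_abs[of "\<lambda>s. k (s\<^sup>2 / real n) - h (s\<^sup>2 / real n)" "\<lambda>_. 2 * e" n] kh
    by (simp add: rademacher_mean_diff rademacher_mean_const)
  have 2: "\<bar>(LINT x|lborel. k (x\<^sup>2) * std_normal_density x) - (LINT x|lborel. h (x\<^sup>2) * std_normal_density x)\<bar> \<le> 2 * e"
  proof -
    define u where "u x = k (x\<^sup>2) * std_normal_density x - h (x\<^sup>2) * std_normal_density x" for x
    have u: "\<bar>u x\<bar> \<le> 2 * e * std_normal_density x" for x
      using mult_right_mono[OF kh[of "x\<^sup>2"], of "std_normal_density x"]
      by (simp add: u_def left_diff_distrib[symmetric] abs_mult)
    have intu: "integrable lborel u" unfolding u_def using inth intk by simp
    have "\<bar>LINT x|lborel. u x\<bar> \<le> (LINT x|lborel. \<bar>u x\<bar>)" by (rule integral_abs_bound)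
    also have "\<dots> \<le> (LINT x|lborel. 2 * e * std_normal_density x)"
      using u intu std_normal_density_mass by (intro integral_mono) auto
    also have "\<dots> = 2 * e" using std_normal_density_mass by simp
    finally show ?thesis using inth intk by (simp add: u_def)
  qed
  have "\<bar>rademacher_mean n (\<lambda>s. k (s\<^sup>2 / real n)) - (LINT x|lborel. k (x\<^sup>2) * std_normal_density x)\<bar>
      \<le> (48 * 1 + 20 * (2 / e)) / real n"
    by (rule rademacher_square_smooth_bound[where h' = k' and h'' = k''])
      (use dk dk' k' k'' n in \<open>auto intro: has_field_derivative_at_within\<close>)
  also have "\<dots> = (48 * 1 + 20 * (2 / e)) * (e * e)" by (simp only: e(2)[symmetric]) simp
  also have "\<dots> = 40 * e + 48 * e * e" using e(1) by (simp add: field_simps)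
  finally have "\<bar>rademacher_mean n (\<lambda>s. h (s\<^sup>2 / real n)) - (LINT x|lborel. h (x\<^sup>2) * std_normal_density x)\<bar>
      \<le> 2 * e + (40 * e + 48 * e * e) + 2 * e" using 1 2 by linarith
  also have "\<dots> = e * (44 + 48 * e)" by (simp add: algebra_simps)
  finally show ?thesis by (simp add: e_def)
qed

section \<open>Friedman's statistic with two treatments\<close>

text \<open>
  For a sign \<open>y\<close> one has \<open>\<phi> (s + y) = \<phi> (s + 1) (1 + y) / 2 + \<phi> (s - 1) (1 - y) / 2\<close>.  This splits the
  last sign off into factors that are independent of the preceding sum and have mean \<open>1 / 2\<close>.
\<close>

lemma (in prob_space) expectation_sum_of_signs:
  fixes X :: "nat \<Rightarrow> 'a \<Rightarrow> real"
  assumes indep: "indep_vars (\<lambda>_. borel) X {1..n}"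
    and sign: "\<And>i \<omega>. i \<in> {1..n} \<Longrightarrow> \<omega> \<in> space M \<Longrightarrow> \<bar>X i \<omega>\<bar> = 1"
    and centred: "\<And>i. i \<in> {1..n} \<Longrightarrow> expectation (X i) = 0"
    and cont: "continuous_on UNIV \<phi>"
  shows "expectation (\<lambda>\<omega>. \<phi> (\<Sum>i=1..n. X i \<omega>)) = rademacher_mean n \<phi>"
  using assms
proof (induction n arbitrary: \<phi>)
  case 0
  then show ?case by (simp add: prob_space)
next
  case (Suc n)
  define S where "S \<omega> = (\<Sum>i=1..n. X i \<omega>)" for \<omega>
  let ?Y = "X (Suc n)"
  have ins: "{1..Suc n} = insert (Suc n) {1..n}" by auto
  have indep_n: "indep_vars (\<lambda>_. borel) X {1..n}"
    using Suc.prems(1) by (rule indep_vars_subset) auto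
  have rv: "X i \<in> borel_measurable M" if "i \<in> {1..Suc n}" for i
    using Suc.prems(1) that by (auto simp: indep_vars_def)
  then have [measurable]: "S \<in> borel_measurable M" "?Y \<in> borel_measurable M"
    unfolding S_def by (auto intro!: borel_measurable_sum)
  have bS: "\<bar>S \<omega>\<bar> \<le> real n" if "\<omega> \<in> space M" for \<omega>
  proof -
    have "\<bar>S \<omega>\<bar> \<le> (\<Sum>i=1..n. \<bar>X i \<omega>\<bar>)" unfolding S_def by (rule sum_abs)
    also have "\<dots> = (\<Sum>i=1..n. 1)" using Suc.prems(2) that by (intro sum.cong) auto
    finally show ?thesis by simp
  qed
  have IH: "expectation (\<lambda>\<omega>. \<psi> (S \<omega>)) = rademacher_mean n \<psi>" if "continuous_on UNIV \<psi>" for \<psi>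
    unfolding S_def using Suc.IH[OF indep_n _ _ that] Suc.prems(2,3) by auto
  have iY: "integrable M ?Y"
    by (rule integrable_const_bound[where B = 1]) (auto simp: Suc.prems(2))
  have EY: "expectation ?Y = 0" using Suc.prems(3)[of "Suc n"] by simp
  have indepYS: "indep_var borel ?Y borel S"
    unfolding S_def using Suc.prems(1) unfolding ins by (intro indep_vars_sum) auto
  have half: "integrable M (\<lambda>\<omega>. \<psi> (S \<omega>) * ((1 + t * ?Y \<omega>) / 2))"
    "expectation (\<lambda>\<omega>. \<psi> (S \<omega>) * ((1 + t * ?Y \<omega>) / 2)) = rademacher_mean n \<psi> / 2"
    if \<psi>: "continuous_on UNIV \<psi>" for \<psi> :: "real \<Rightarrow> real" and t
  proof -
    have [measurable]: "\<psi> \<in> borel_measurable borel"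
      using \<psi> by (rule borel_measurable_continuous_onI)
    have "compact (\<psi> ` {- real n..real n})"
      by (intro compact_continuous_image continuous_on_subset[OF \<psi>]) auto
    then obtain C where C: "\<And>x. x \<in> {- real n..real n} \<Longrightarrow> \<bar>\<psi> x\<bar> \<le> C"
      using compact_imp_bounded bounded_iff by (metis imageI real_norm_def)
    have "norm (\<psi> (S \<omega>)) \<le> C" if "\<omega> \<in> space M" for \<omega>
      using C[of "S \<omega>"] bS[OF that] by (simp add: abs_le_iff)
    then have i1: "integrable M (\<lambda>\<omega>. \<psi> (S \<omega>))"
      by (intro integrable_const_bound[where B = C] AE_I2) auto
    have i2: "integrable M (\<lambda>\<omega>. (1 + t * ?Y \<omega>) / 2)" using iY by auto
    have "indep_var borel ((\<lambda>y. (1 + t * y) / 2) \<circ> ?Y) borel (\<psi> \<circ> S)"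
      by (rule indep_var_compose[OF indepYS]) auto
    then have ind: "indep_var borel (\<lambda>\<omega>. (1 + t * ?Y \<omega>) / 2) borel (\<lambda>\<omega>. \<psi> (S \<omega>))"
      by (simp add: o_def)
    show "integrable M (\<lambda>\<omega>. \<psi> (S \<omega>) * ((1 + t * ?Y \<omega>) / 2))"
      using indep_var_integrable[OF ind i2 i1] by (simp add: mult.commute)
    have "expectation (\<lambda>\<omega>. (1 + t * ?Y \<omega>) / 2) = 1 / 2"
      using iY EY by (simp add: prob_space)
    then show "expectation (\<lambda>\<omega>. \<psi> (S \<omega>) * ((1 + t * ?Y \<omega>) / 2)) = rademacher_mean n \<psi> / 2"
      using indep_var_lebesgue_integral[OF ind i2 i1] IH[OF \<psi>] by (simp add: mult.commute)
  qed
  have c1: "continuous_on UNIV (\<lambda>s. \<phi> (s + 1))" and c2: "continuous_on UNIV (\<lambda>s. \<phi> (s - 1))"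
    by (auto intro!: continuous_on_compose2[OF Suc.prems(4)] continuous_intros)
  have "expectation (\<lambda>\<omega>. \<phi> (\<Sum>i=1..Suc n. X i \<omega>))
      = expectation (\<lambda>\<omega>. \<phi> (S \<omega> + 1) * ((1 + 1 * ?Y \<omega>) / 2) + \<phi> (S \<omega> - 1) * ((1 + (- 1) * ?Y \<omega>) / 2))"
  proof (rule Bochner_Integration.integral_cong[OF refl])
    fix \<omega> assume "\<omega> \<in> space M"
    then have "?Y \<omega> = 1 \<or> ?Y \<omega> = - 1" using Suc.prems(2)[of "Suc n" \<omega>] by (auto simp: abs_if split: if_splits)
    then show "\<phi> (\<Sum>i=1..Suc n. X i \<omega>)
        = \<phi> (S \<omega> + 1) * ((1 + 1 * ?Y \<omega>) / 2) + \<phi> (S \<omega> - 1) * ((1 + (- 1) * ?Y \<omega>) / 2)"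
      by (auto simp: S_def)
  qed
  also have "\<dots> = rademacher_mean n (\<lambda>s. \<phi> (s + 1)) / 2 + rademacher_mean n (\<lambda>s. \<phi> (s - 1)) / 2"
    using half[OF c1, of 1] half[OF c2, of "- 1"] by simp
  finally show ?case by (simp add: add_divide_distrib)
qed

lemma permutes_two_cases:
  assumes "p permutes {1..2::nat}"
  shows "p 1 = 1 \<and> p 2 = 2 \<or> p 1 = 2 \<and> p 2 = 1"
proof -
  have "p 1 \<in> {1..2}" "p 2 \<in> {1..2}" using permutes_in_image[OF assms] by auto
  moreover have "p 1 \<noteq> p 2" using injD[OF permutes_inj[OF assms], of 1 2] by auto
  ultimately show ?thesis by auto
qed

lemma sum_perms_two: "(\<Sum>p\<in>perms 2. 2 * real (p 1) - 3) = 0"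
proof -
  have "perms 2 = {id, Transposition.transpose 1 2}"
  proof -
    have "{1..2::nat} = {1, 2}" by auto
    then show ?thesis by (auto simp: permutes_doubleton_iff)
  qed
  moreover have "(id :: nat \<Rightarrow> nat) \<noteq> Transposition.transpose 1 2"
    by (metis id_apply one_eq_numeral_iff semiring_norm(85) transpose_apply_first)
  ultimately show ?thesis by simp
qed

text \<open>
  A permutation of two points is determined by the sign \<open>2 \<pi>(1) - 3\<close>, and its two centred ranks are
  plus and minus half of that sign; so the two terms of Friedman's statistic coincide.
\<close>

lemma friedman_F_two:
  assumes "\<And>i. i \<in> {1..n} \<Longrightarrow> \<pi> i \<omega> permutes {1..2}"
  shows "friedman_F 2 n \<pi> \<omega> = (\<Sum>i=1..n. 2 * real (\<pi> i \<omega> 1) - 3)\<^sup>2 / real n"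
proof -
  define T where "T = (\<Sum>i=1..n. 2 * real (\<pi> i \<omega> 1) - 3)"
  have "(\<Sum>i=1..n. friedman_rho 2 (\<pi> i \<omega>) 1) = (\<Sum>i=1..n. (2 * real (\<pi> i \<omega> 1) - 3) / 2)"
    by (intro sum.cong) (auto simp: friedman_rho_def field_simps)
  then have r1: "(\<Sum>i=1..n. friedman_rho 2 (\<pi> i \<omega>) 1) = T / 2"
    by (simp add: T_def sum_divide_distrib)
  have "(\<Sum>i=1..n. friedman_rho 2 (\<pi> i \<omega>) 2) = (\<Sum>i=1..n. - (2 * real (\<pi> i \<omega> 1) - 3) / 2)"
    using permutes_two_cases[OF assms] by (intro sum.cong) (fastforce simp: friedman_rho_def)+
  then have r2: "(\<Sum>i=1..n. friedman_rho 2 (\<pi> i \<omega>) 2) = - T / 2"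
    by (simp add: T_def sum_divide_distrib sum_negf[symmetric])
  have "{1..2::nat} = {1, 2}" by auto
  then have "friedman_F 2 n \<pi> \<omega>
      = (sqrt 12 / sqrt (6 * real n) * (T / 2))\<^sup>2 + (sqrt 12 / sqrt (6 * real n) * (- T / 2))\<^sup>2"
    unfolding friedman_F_def friedman_S_def by (simp add: r1[unfolded One_nat_def] r2[simplified] mult.commute)
  also have "\<dots> = T\<^sup>2 / real n"
    by (cases "n = 0") (simp_all add: power_mult_distrib power_divide)
  finally show ?thesis unfolding T_def .
qed

lemma integral_friedman_F_two:
  fixes h :: "real \<Rightarrow> real"
  assumes iid: "iid_uniform_perms M 2 n \<pi>" and cont: "continuous_on {0..} h"
  shows "(LINT \<omega>|M. h (friedman_F 2 n \<pi> \<omega>)) = rademacher_mean n (\<lambda>s. h (s\<^sup>2 / real n))"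
proof -
  define X where "X i \<omega> = 2 * real (\<pi> i \<omega> 1) - 3" for i \<omega>
  interpret prob_space M using iid by (simp add: iid_uniform_perms_def)
  have indep: "indep_vars (\<lambda>_. count_space (perms 2)) \<pi> {1..n}"
    and unif: "\<And>i. i \<in> {1..n} \<Longrightarrow> distr M (count_space (perms 2)) (\<pi> i) = uniform_count_measure (perms 2)"
    using iid by (auto simp: iid_uniform_perms_def)
  have rv: "\<pi> i \<in> measurable M (count_space (perms 2))" if "i \<in> {1..n}" for i
    using indep that by (auto simp: indep_vars_def)
  have perm: "\<pi> i \<omega> permutes {1..2}" if "i \<in> {1..n}" "\<omega> \<in> space M" for i \<omega>
    using measurable_space[OF rv[OF that(1)] that(2)] by simp
  have "(LINT \<omega>|M. h (friedman_F 2 n \<pi> \<omega>)) = (LINT \<omega>|M. h ((\<Sum>i=1..n. X i \<omega>)\<^sup>2 / real n))"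
    unfolding X_def
    by (rule Bochner_Integration.integral_cong[OF refl]) (subst friedman_F_two[OF perm]; simp)
  also have "\<dots> = rademacher_mean n (\<lambda>s. h (s\<^sup>2 / real n))"
  proof (rule expectation_sum_of_signs)
    show "indep_vars (\<lambda>_. borel) X {1..n}"
      unfolding X_def using indep_vars_compose2[OF indep, of "\<lambda>_ p. 2 * real (p 1) - 3" "\<lambda>_. borel"] by simp
    show "\<bar>X i \<omega>\<bar> = 1" if "i \<in> {1..n}" "\<omega> \<in> space M" for i \<omega>
      using permutes_two_cases[OF perm[OF that]] by (auto simp: X_def)
    show "expectation (X i) = 0" if "i \<in> {1..n}" for i
    proof -
      have "expectation (X i) = (LINT p|distr M (count_space (perms 2)) (\<pi> i). 2 * real (p 1) - 3)"
        unfolding X_def by (rule integral_distr[OF rv[OF that], symmetric]) simp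
      also have "\<dots> = 0"
        unfolding unif[OF that] using sum_perms_two finite_permutations[of "{1..2::nat}"]
        by (simp add: integral_uniform_count_measure)
      finally show ?thesis .
    qed
    show "continuous_on UNIV (\<lambda>s. h (s\<^sup>2 / real n))"
      unfolding divide_inverse
      by (rule continuous_on_compose2[OF cont]) (auto intro!: continuous_intros)
  qed
  finally show ?thesis .
qed

lemma friedman_F_measurable:
  assumes iid: "iid_uniform_perms M 2 n \<pi>"
  shows "friedman_F 2 n \<pi> \<in> borel_measurable M"
proof -
  interpret prob_space M using iid by (simp add: iid_uniform_perms_def)
  have rv: "\<pi> i \<in> measurable M (count_space (perms 2))" if "i \<in> {1..n}" for i
    using iid that by (auto simp: iid_uniform_perms_def indep_vars_def)
  have "(\<lambda>\<omega>. friedman_rho 2 (\<pi> i \<omega>) j) \<in> borel_measurable M" if "i \<in> {1..n}" for i j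
    using measurable_compose[OF rv[OF that], of "\<lambda>p. friedman_rho 2 p j" borel] by simp
  then show ?thesis
    unfolding friedman_F_def[abs_def] friedman_S_def
    by (intro borel_measurable_sum borel_measurable_power borel_measurable_times) auto
qed

section \<open>Comparison with the chi-square law\<close>

lemma integral_chi_square_1:
  fixes k :: "real \<Rightarrow> real"
  assumes [measurable]: "k \<in> borel_measurable borel"
  shows "(LINT x|chi_square 1. k x) = (LINT x|lborel. k (x\<^sup>2) * std_normal_density x)"
proof -
  interpret N: prob_space std_normal_distribution
    by (rule prob_space_normal_density) simp
  interpret product_sigma_finite "\<lambda>_::nat. std_normal_distribution" ..
  have "(LINT x|chi_square 1. k x) = (LINT z|Pi\<^sub>M {1::nat} (\<lambda>_. std_normal_distribution). k ((z 1)\<^sup>2))"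
    unfolding chi_square_def by (subst integral_distr) auto
  also have "\<dots> = (LINT x|std_normal_distribution. k (x\<^sup>2))"
    by (rule product_integral_singleton) simp
  also have "\<dots> = (LINT x|lborel. k (x\<^sup>2) * std_normal_density x)"
    by (subst integral_density) (auto simp: mult.commute)
  finally show ?thesis .
qed

text \<open>
  Only the restriction of \<open>h\<close> to the half line is controlled, so measurability is available for
  the truncated function alone.
\<close>

lemma chi_square_expectation_1:
  assumes "continuous_on {0..} h"
  shows "chi_square_expectation 1 h = (LINT x|lborel. h (x\<^sup>2) * std_normal_density x)"
proof -
  have "(\<lambda>x. indicator {0..} x *\<^sub>R h x) \<in> borel_measurable borel"
    using assms by (intro borel_measurable_continuous_on_indicator) auto
  then show ?thesis
    unfolding chi_square_expectation_def set_lebesgue_integral_def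
    by (subst integral_chi_square_1) (auto simp: indicator_def)
qed

lemma Cb_1_2_derivatives:
  assumes "h \<in> Cb 1 2"
  defines "h' \<equiv> deriv_nonneg 1 h" and "h'' \<equiv> deriv_nonneg 2 h"
  shows "0 \<le> x \<Longrightarrow> (h has_real_derivative h' x) (at x within {0..})"
    and "0 \<le> x \<Longrightarrow> (h' has_real_derivative h'' x) (at x within {0..})"
    and "0 \<le> x \<Longrightarrow> \<bar>h' x\<bar> \<le> sup_norm_nonneg h'"
    and "0 \<le> x \<Longrightarrow> \<bar>h'' x\<bar> \<le> sup_norm_nonneg h''"
proof -
  have diff: "deriv_nonneg i h differentiable_on {0..}" if "i < 2" for i
    using assms(1) that by (simp add: Cb_def)
  have deriv: "(deriv_nonneg i h has_real_derivative deriv_nonneg (Suc i) h x) (at x within {0..})"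
    if "i < 2" "0 \<le> x" for i x
    using diff[OF that(1)] that(2) vector_derivative_works
    unfolding differentiable_on_def has_real_derivative_iff_has_vector_derivative
    by (fastforce simp: deriv_nonneg_def)
  show "0 \<le> x \<Longrightarrow> (h has_real_derivative h' x) (at x within {0..})"
    using deriv[of 0 x] by (simp add: h'_def deriv_nonneg_def)
  show "0 \<le> x \<Longrightarrow> (h' has_real_derivative h'' x) (at x within {0..})"
    using deriv[of 1 x] by (simp add: h'_def h''_def numeral_2_eq_2)
  have bound: "\<bar>deriv_nonneg i h x\<bar> \<le> sup_norm_nonneg (deriv_nonneg i h)" if "i \<in> {1..2}" "0 \<le> x" for i x
  proof -
    have "bounded (deriv_nonneg i h ` {0..})" using assms(1) that(1) by (simp add: Cb_def)
    then obtain C where "\<And>y. 0 \<le> y \<Longrightarrow> \<bar>deriv_nonneg i h y\<bar> \<le> C"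
      unfolding bounded_iff by auto
    then have "bdd_above ((\<lambda>y. \<bar>deriv_nonneg i h y\<bar>) ` {0..})" by (auto intro!: bdd_aboveI2)
    then show ?thesis unfolding sup_norm_nonneg_def using that(2) by (intro cSUP_upper) auto
  qed
  show "0 \<le> x \<Longrightarrow> \<bar>h' x\<bar> \<le> sup_norm_nonneg h'"
    and "0 \<le> x \<Longrightarrow> \<bar>h'' x\<bar> \<le> sup_norm_nonneg h''"
    using bound[of 1 x] bound[of 2 x] by (simp_all add: h'_def h''_def)
qed

theorem proposition1p5:
  fixes M :: "'a measure" and n :: nat and \<pi> :: "nat \<Rightarrow> 'a \<Rightarrow> nat \<Rightarrow> nat"
  assumes "n \<ge> 1"
    and "iid_uniform_perms M 2 n \<pi>"
  shows "wasserstein (distr M borel (friedman_F 2 n \<pi>)) (chi_square 1)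
           \<le> ennreal (1 / sqrt (real n) * (87 + 48 / sqrt (real n)))
       \<and> (\<forall>h\<in>Cb 1 2.
             \<bar>(LINT \<omega>|M. h (friedman_F 2 n \<pi> \<omega>)) - chi_square_expectation 1 h\<bar>
               \<le> 1 / real n * (69 + 43 / real n)
                   * (sup_norm_nonneg (deriv_nonneg 1 h) + sup_norm_nonneg (deriv_nonneg 2 h)))"
proof (intro conjI ballI)
  show "wasserstein (distr M borel (friedman_F 2 n \<pi>)) (chi_square 1)
      \<le> ennreal (1 / sqrt (real n) * (87 + 48 / sqrt (real n)))"
    unfolding wasserstein_def
  proof (rule SUP_least, rule ennreal_leI)
    fix h :: "real \<Rightarrow> real" assume "h \<in> {h. 1-lipschitz_on UNIV h}"
    then have lip: "1-lipschitz_on UNIV h" by simp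
    have cont: "continuous_on UNIV h" using lip by (rule lipschitz_on_continuous_on)
    have [measurable]: "h \<in> borel_measurable borel"
      using cont by (rule borel_measurable_continuous_onI)
    have "(LINT x|distr M borel (friedman_F 2 n \<pi>). h x) = rademacher_mean n (\<lambda>s. h (s\<^sup>2 / real n))"
      using integral_friedman_F_two[OF assms(2) continuous_on_subset[OF cont]]
      by (simp add: integral_distr[OF friedman_F_measurable[OF assms(2)]])
    then have "\<bar>(LINT x|distr M borel (friedman_F 2 n \<pi>). h x) - (LINT x|chi_square 1. h x)\<bar>
        \<le> 1 / sqrt (real n) * (44 + 48 / sqrt (real n))"
      using rademacher_square_lipschitz_bound[OF lip assms(1)] integral_chi_square_1[of h] by simp
    also have "\<dots> \<le> 1 / sqrt (real n) * (87 + 48 / sqrt (real n))"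
      by (intro mult_left_mono) auto
    finally show "\<bar>(LINT x|distr M borel (friedman_F 2 n \<pi>). h x) - (LINT x|chi_square 1. h x)\<bar>
        \<le> 1 / sqrt (real n) * (87 + 48 / sqrt (real n))" .
  qed
next
  fix h assume h: "h \<in> Cb 1 2"
  define A where "A = sup_norm_nonneg (deriv_nonneg 1 h)"
  define B where "B = sup_norm_nonneg (deriv_nonneg 2 h)"
  note d = Cb_1_2_derivatives[OF h, folded A_def B_def]
  have A0: "0 \<le> A" and B0: "0 \<le> B"
    using d(3)[of 0] d(4)[of 0] by auto
  have cont: "continuous_on {0..} h" using d(1) by (auto intro!: DERIV_continuous_on)
  have "\<bar>(LINT \<omega>|M. h (friedman_F 2 n \<pi> \<omega>)) - chi_square_expectation 1 h\<bar> \<le> (48 * A + 20 * B) / real n"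
    unfolding integral_friedman_F_two[OF assms(2) cont] chi_square_expectation_1[OF cont]
    by (rule rademacher_square_smooth_bound[OF d assms(1)])
  also have "\<dots> \<le> 69 * (A + B) / real n"
    using A0 B0 by (intro divide_right_mono) auto
  also have "\<dots> = 1 / real n * 69 * (A + B)" by simp
  also have "\<dots> \<le> 1 / real n * (69 + 43 / real n) * (A + B)"
    using A0 B0 by (intro mult_right_mono mult_left_mono) auto
  finally show "\<bar>(LINT \<omega>|M. h (friedman_F 2 n \<pi> \<omega>)) - chi_square_expectation 1 h\<bar>
      \<le> 1 / real n * (69 + 43 / real n)
          * (sup_norm_nonneg (deriv_nonneg 1 h) + sup_norm_nonneg (deriv_nonneg 2 h))"
    unfolding A_def B_def .
qed

end
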